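(* Let $k\ge 3$ be an integer. The folded $k$-cube graph $FQ_k$ is super matched if and only if $k\ge 4$.
   Context: The folded $k$-cube graph $FQ_k$ ($k\ge 3$) has $2^{k-1}$ vertices and is formed from the $(k-1)$-dimensional hypercube graph (vertices: binary strings of length $k-1$; two adjacent when they differ in exactly one coordinate) by adding edges between opposite pairs of vertices (pairs of strings differing in all $k-1$ coordinates). For a graph $G$ of even order, a matching preclusion set is a set $S\subseteq E(G)$ such that $G-S$ (the graph obtained by deleting the edges in $S$) has no perfect matching. The matching preclusion number $mp(G)$ is the minimum cardinality of a matching preclusion set. An optimal matching preclusion set (optimal solution) is a matching preclusion set of cardinality $mp(G)$. An optimal solution is trivial if it is the set of all edges incident with a single vertex. $G$ is super matched if all its optimal solutions are trivial. *)

theory Defs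
  imports Main
begin

text \<open>A finite simple graph is a pair of a vertex set and a set of edges, each edge being a
  two-element set of vertices.\<close>

type_synonym 'a ugraph = "'a set \<times> 'a set set"

abbreviation gverts :: "'a ugraph \<Rightarrow> 'a set" where
  "gverts G \<equiv> fst G"

abbreviation gedges :: "'a ugraph \<Rightarrow> 'a set set" where
  "gedges G \<equiv> snd G"

definition simple_graph :: "'a ugraph \<Rightarrow> bool" where
  "simple_graph G \<longleftrightarrow> finite (gverts G) \<and> (\<forall>e\<in>gedges G. e \<subseteq> gverts G \<and> card e = 2)"

definition delete_edges :: "'a ugraph \<Rightarrow> 'a set set \<Rightarrow> 'a ugraph" where
  "delete_edges G S = (gverts G, gedges G - S)"

definition perfect_matching :: "'a ugraph \<Rightarrow> 'a set set \<Rightarrow> bool" where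
  "perfect_matching G M \<longleftrightarrow> M \<subseteq> gedges G \<and> pairwise disjnt M \<and> \<Union>M = gverts G"

text \<open>The following notions are meant for simple graphs of even order, where this assumption
  is not repeated in each definition.\<close>

definition matching_preclusion_set :: "'a ugraph \<Rightarrow> 'a set set \<Rightarrow> bool" where
  "matching_preclusion_set G S \<longleftrightarrow>
     S \<subseteq> gedges G \<and> \<not> (\<exists>M. perfect_matching (delete_edges G S) M)"

definition mp :: "'a ugraph \<Rightarrow> nat" where
  "mp G = (LEAST n. \<exists>S. matching_preclusion_set G S \<and> card S = n)"

definition optimal_solution :: "'a ugraph \<Rightarrow> 'a set set \<Rightarrow> bool" where
  "optimal_solution G S \<longleftrightarrow> matching_preclusion_set G S \<and> card S = mp G"

definition trivial_solution :: "'a ugraph \<Rightarrow> 'a set set \<Rightarrow> bool" where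
  "trivial_solution G S \<longleftrightarrow> (\<exists>v\<in>gverts G. S = {e \<in> gedges G. v \<in> e})"

definition super_matched :: "'a ugraph \<Rightarrow> bool" where
  "super_matched G \<longleftrightarrow> (\<forall>S. optimal_solution G S \<longrightarrow> trivial_solution G S)"

definition bin_strings :: "nat \<Rightarrow> bool list set" where
  "bin_strings d = {x. length x = d}"

definition hypercube :: "nat \<Rightarrow> bool list ugraph" where
  "hypercube d =
     (bin_strings d,
      {{x, y} | x y. x \<in> bin_strings d \<and> y \<in> bin_strings d \<and>
                     card {i. i < d \<and> x ! i \<noteq> y ! i} = 1})"

definition opposite_pairs :: "nat \<Rightarrow> bool list set set" where
  "opposite_pairs d =
     {{x, y} | x y. x \<in> bin_strings d \<and> y \<in> bin_strings d \<and> (\<forall>i<d. x ! i \<noteq> y ! i)}"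

definition folded_cube :: "nat \<Rightarrow> bool list ugraph" where
  "folded_cube k =
     (gverts (hypercube (k - 1)), gedges (hypercube (k - 1)) \<union> opposite_pairs (k - 1))"

lemma card_gverts_folded_cube: "card (gverts (folded_cube k)) = 2 ^ (k - 1)"
  using card_lists_length_eq[of "UNIV :: bool set" "k - 1"]
  by (simp add: folded_cube_def hypercube_def bin_strings_def)

lemma simple_graph_folded_cube:
  assumes "k \<ge> 2"
  shows "simple_graph (folded_cube k)"
proof -
  have "finite (gverts (folded_cube k))"
    using card_gverts_folded_cube[of k] by (intro card_ge_0_finite) simp
  moreover have "e \<subseteq> gverts (folded_cube k) \<and> card e = 2" if "e \<in> gedges (folded_cube k)" for e
  proof -
    from that obtain x y where e: "e = {x, y}" "x \<in> bin_strings (k - 1)" "y \<in> bin_strings (k - 1)"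
      and "card {i. i < k - 1 \<and> x ! i \<noteq> y ! i} = 1 \<or> (\<forall>i<k - 1. x ! i \<noteq> y ! i)"
      by (auto simp: folded_cube_def hypercube_def opposite_pairs_def)
    then have "x \<noteq> y"
      using assms by (auto dest: spec[of _ 0])
    with e show ?thesis
      by (simp add: folded_cube_def hypercube_def)
  qed
  ultimately show ?thesis
    by (simp add: simple_graph_def)
qed

end

theory Submission
  imports Defs
begin

text \<open>
  The folded cube is a Cayley graph of an elementary abelian 2-group: its \<open>k\<close> generators are the
  \<open>k - 1\<close> coordinate flips and the complementation of the whole string.  The argument uses only
  that the generators are commuting involutions without fixed points, no two of which agree at
  any vertex, so it is carried out for such families in general.

  The edges of one generator form a perfect matching, a \<^emph>\<open>direction class\<close>, and the classes
  partition the edge set.  A matching preclusion set must meet each of the \<open>k\<close> classes, and a star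
  has \<open>k\<close> edges; hence \<open>mp = k\<close> and an optimal solution contains exactly one edge of each class
  (\<open>optimal_solution_transversal\<close>).

  The edges of two classes together form disjoint 4-cycles.  If the two edges of an optimal
  solution \<open>S\<close> in these classes were disjoint, they would lie in different 4-cycles, because edges
  of different directions in one 4-cycle always meet.  Then one of the classes could be repaired
  by exchanging its deleted edge along its 4-cycle, which would give a perfect matching avoiding
  \<open>S\<close> (\<open>transversal_edges_meet\<close>).  So \<open>S\<close> consists of \<open>k\<close> pairwise intersecting edges: it is
  contained in a star or it is a triangle.  For \<open>k \<ge> 4\<close> only the star is left, and it must be a
  full one because both have \<open>k\<close> edges.  For \<open>k = 3\<close> the graph is \<open>K\<^sub>4\<close>, where a triangle is
  indeed a nontrivial optimal solution.
\<close>

section \<open>Graphs generated by commuting involutions\<close>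

lemma pairwise_intersecting_pairs_common_element:
  assumes two: "\<And>e. e \<in> S \<Longrightarrow> card e = 2"
    and meet: "\<And>e e'. e \<in> S \<Longrightarrow> e' \<in> S \<Longrightarrow> e \<inter> e' \<noteq> {}"
    and four: "card S \<ge> 4"
  shows "\<exists>v. \<forall>e\<in>S. v \<in> e"
proof -
  have outside: "\<exists>e. e \<in> S \<and> e \<notin> F" if "finite F" "card F \<le> 3" for F
    using card_mono[OF that(1), of S] that four by auto
  have pair: "e = {x, y}" if "e \<in> S" "x \<in> e" "y \<in> e" "x \<noteq> y" for e x y
    using two[OF that(1)] that(2-4) by (auto simp: card_2_iff)
  obtain p where p: "p \<in> S"
    using outside[of "{}"] by auto
  obtain q where q: "q \<in> S" "q \<noteq> p"
    using outside[of "{p}"] by auto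
  obtain a where a: "a \<in> p" "a \<in> q"
    using meet[OF p q(1)] by auto
  obtain b where b: "p = {a, b}" "a \<noteq> b"
    using two[OF p] a(1) by (auto simp: card_2_iff)
  obtain c where c: "q = {a, c}" "a \<noteq> c"
    using two[OF q(1)] a(2) by (auto simp: card_2_iff)
  have "\<forall>e\<in>S. a \<in> e"
  proof (rule ccontr)
    assume "\<not> ?thesis"
    then obtain r where r: "r \<in> S" "a \<notin> r" by blast
    \<comment> \<open>The three edges would form a triangle, which no fourth edge can meet in all its sides.\<close>
    have "b \<in> r" "c \<in> r"
      using meet[OF p r(1)] meet[OF q(1) r(1)] b c r(2) by auto
    then have r_eq: "r = {b, c}"
      using pair[OF r(1)] q(2) b(1) c(1) by blast
    have "card {p, q, r} \<le> 3"
      by (simp add: card_insert_if)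
    then obtain s where s: "s \<in> S" "s \<notin> {p, q, r}"
      using outside[of "{p, q, r}"] by auto
    have "a \<in> s \<or> b \<in> s" "a \<in> s \<or> c \<in> s" "b \<in> s \<or> c \<in> s"
      using meet[OF s(1) p] meet[OF s(1) q(1)] meet[OF s(1) r(1)] b(1) c(1) r_eq by blast+
    moreover have "b \<noteq> c" using q(2) b c by blast
    ultimately have "s = {a, b} \<or> s = {a, c} \<or> s = {b, c}"
      using pair[OF s(1)] b(2) c(2) by metis
    then show False
      using s(2) b(1) c(1) r_eq by simp
  qed
  then show ?thesis ..
qed

locale involution_graph =
  fixes V :: "'a set" and I :: "'i set" and f :: "'i \<Rightarrow> 'a \<Rightarrow> 'a"
  assumes finite_V: "finite V" and nonempty_V: "V \<noteq> {}" and finite_I: "finite I"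
    and closed: "\<lbrakk>i \<in> I; x \<in> V\<rbrakk> \<Longrightarrow> f i x \<in> V"
    and involution: "\<lbrakk>i \<in> I; x \<in> V\<rbrakk> \<Longrightarrow> f i (f i x) = x"
    and commute: "\<lbrakk>i \<in> I; j \<in> I; x \<in> V\<rbrakk> \<Longrightarrow> f i (f j x) = f j (f i x)"
    and moves: "\<lbrakk>i \<in> I; x \<in> V\<rbrakk> \<Longrightarrow> f i x \<noteq> x"
    and separates: "\<lbrakk>i \<in> I; j \<in> I; i \<noteq> j; x \<in> V\<rbrakk> \<Longrightarrow> f i x \<noteq> f j x"
begin

definition direction_class :: "'i \<Rightarrow> 'a set set" where
  "direction_class i = (\<lambda>x. {x, f i x}) ` V"

definition graph :: "'a ugraph" where
  "graph = (V, \<Union>i\<in>I. direction_class i)"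

definition star :: "'a \<Rightarrow> 'a set set" where
  "star v = {e \<in> gedges graph. v \<in> e}"

lemma direction_class_edge_at:
  assumes "i \<in> I" "e \<in> direction_class i" "v \<in> e"
  shows "v \<in> V \<and> e = {v, f i v}"
  using assms by (auto simp: direction_class_def involution closed)

lemma edge_card_2: "e \<in> gedges graph \<Longrightarrow> card e = 2"
  using moves by (fastforce simp: graph_def direction_class_def card_2_iff)

lemma edge_subset: "e \<in> gedges graph \<Longrightarrow> e \<subseteq> V"
  by (auto simp: graph_def direction_class_def closed)

lemma finite_edges: "finite (gedges graph)"
  by (simp add: graph_def direction_class_def finite_V finite_I)

lemma direction_classes_disjoint:
  assumes "i \<in> I" "j \<in> I" "i \<noteq> j"
  shows "direction_class i \<inter> direction_class j = {}"
proof (rule ccontr)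
  assume "\<not> ?thesis"
  then obtain x where x: "x \<in> V" "{x, f i x} \<in> direction_class j"
    by (auto simp: direction_class_def)
  then have "{x, f i x} = {x, f j x}"
    using direction_class_edge_at[OF assms(2), of "{x, f i x}" x] by simp
  then show False
    using separates[OF assms x(1)] by (auto simp: doubleton_eq_iff)
qed

lemma star_eq:
  assumes "v \<in> V"
  shows "star v = (\<lambda>i. {v, f i v}) ` I"
proof
  show "star v \<subseteq> (\<lambda>i. {v, f i v}) ` I"
  proof
    fix e assume "e \<in> star v"
    then obtain i where i: "i \<in> I" "e \<in> direction_class i" "v \<in> e"
      by (auto simp: star_def graph_def)
    then show "e \<in> (\<lambda>i. {v, f i v}) ` I"
      using direction_class_edge_at[OF i] by blast
  qed
  show "(\<lambda>i. {v, f i v}) ` I \<subseteq> star v"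
    using assms by (auto simp: star_def graph_def direction_class_def)
qed

lemma card_star:
  assumes "v \<in> V"
  shows "card (star v) = card I"
  unfolding star_eq[OF assms]
proof (rule card_image, rule inj_onI)
  fix i j assume ij: "i \<in> I" "j \<in> I" "{v, f i v} = {v, f j v}"
  then have "f i v = f j v" by (auto simp: doubleton_eq_iff)
  then show "i = j" using separates[OF ij(1,2) _ assms] by blast
qed

text \<open>All perfect matchings needed here are described by choosing at each vertex the direction of
  the matching edge: it suffices that the other end of that edge chooses the same direction.\<close>

lemma perfect_matching_from_directions:
  assumes dir: "\<And>x. x \<in> V \<Longrightarrow> g x \<in> I"
    and agree: "\<And>x. x \<in> V \<Longrightarrow> g (f (g x) x) = g x"
    and avoid: "\<And>x. x \<in> V \<Longrightarrow> {x, f (g x) x} \<notin> S"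
  shows "perfect_matching (delete_edges graph S) ((\<lambda>x. {x, f (g x) x}) ` V)"
proof -
  let ?m = "\<lambda>x. {x, f (g x) x}"
  have same: "?m z = ?m x" if "x \<in> V" "z \<in> ?m x" for x z
    using that dir agree involution by (auto simp: insert_commute)
  have "pairwise disjnt (?m ` V)"
  proof (rule pairwiseI)
    fix e e' assume e: "e \<in> ?m ` V" "e' \<in> ?m ` V" "e \<noteq> e'"
    have False if "z \<in> e" "z \<in> e'" for z
      using e that same by (metis (no_types, lifting) imageE)
    then show "disjnt e e'" by (auto simp: disjnt_def)
  qed
  moreover have "?m ` V \<subseteq> gedges graph - S"
    using dir avoid by (auto simp: graph_def direction_class_def)
  moreover have "\<Union>(?m ` V) = V"
    using dir closed by auto
  ultimately show ?thesis
    by (simp add: perfect_matching_def delete_edges_def graph_def)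
qed

section \<open>Optimal solutions as transversals of the direction classes\<close>

lemma preclusion_meets_direction_class:
  assumes "matching_preclusion_set graph S" "i \<in> I"
  shows "\<exists>e. e \<in> S \<and> e \<in> direction_class i"
  using assms perfect_matching_from_directions[of "\<lambda>_. i" S]
  by (auto simp: matching_preclusion_set_def direction_class_def)

lemma preclusion_representatives:
  assumes "matching_preclusion_set graph S"
  obtains s where "\<And>i. i \<in> I \<Longrightarrow> s i \<in> S" "\<And>i. i \<in> I \<Longrightarrow> s i \<in> direction_class i" "inj_on s I"
proof -
  obtain s where s: "\<And>i. i \<in> I \<Longrightarrow> s i \<in> S \<and> s i \<in> direction_class i"
    using preclusion_meets_direction_class[OF assms] by metis
  moreover have "inj_on s I"
    using s direction_classes_disjoint by (fastforce simp: inj_on_def)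
  ultimately show thesis using that by blast
qed

lemma finite_preclusion: "matching_preclusion_set graph S \<Longrightarrow> finite S"
  using finite_edges finite_subset by (auto simp: matching_preclusion_set_def)

lemma card_preclusion_ge:
  assumes "matching_preclusion_set graph S"
  shows "card I \<le> card S"
proof -
  obtain s where "\<And>i. i \<in> I \<Longrightarrow> s i \<in> S" "inj_on s I"
    using preclusion_representatives[OF assms] by metis
  then show ?thesis
    using card_inj_on_le[of s I S] finite_preclusion[OF assms] by auto
qed

lemma star_preclusion:
  assumes "v \<in> V"
  shows "matching_preclusion_set graph (star v)"
proof -
  have False if M: "perfect_matching (delete_edges graph (star v)) M" for M
  proof -
    obtain e where "e \<in> M" "v \<in> e"
      using M assms by (auto simp: perfect_matching_def delete_edges_def graph_def)
    then show False
      using M by (auto simp: perfect_matching_def delete_edges_def star_def)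
  qed
  then show ?thesis
    by (auto simp: matching_preclusion_set_def star_def)
qed

lemma mp_graph: "mp graph = card I"
  unfolding mp_def
proof (rule Least_equality)
  obtain v where "v \<in> V" using nonempty_V by blast
  then show "\<exists>S. matching_preclusion_set graph S \<and> card S = card I"
    using star_preclusion card_star by blast
qed (use card_preclusion_ge in auto)

lemma optimal_solution_transversal:
  assumes "optimal_solution graph S"
  obtains s where "S = s ` I" "\<And>i. i \<in> I \<Longrightarrow> s i \<in> direction_class i"
proof -
  have S: "matching_preclusion_set graph S" "card S = card I"
    using assms by (auto simp: optimal_solution_def mp_graph)
  obtain s where s: "\<And>i. i \<in> I \<Longrightarrow> s i \<in> S" "\<And>i. i \<in> I \<Longrightarrow> s i \<in> direction_class i" "inj_on s I"
    by (rule preclusion_representatives[OF S(1)]) (rule that)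
  have "s ` I = S"
    using s S(2) finite_preclusion[OF S(1)] by (intro card_subset_eq) (auto simp: card_image)
  with s(2) that show thesis by blast
qed

text \<open>The exchange argument: of two deleted edges in directions \<open>i\<close> and \<open>j\<close>, let \<open>Q\<close> be the
  4-cycle through the first.  Matching in direction \<open>j\<close> inside \<open>Q\<close> and in direction \<open>i\<close> outside
  avoids the first edge, and it avoids the second unless that edge lies in \<open>Q\<close>; but each edge of
  direction \<open>j\<close> in \<open>Q\<close> meets each edge of direction \<open>i\<close> in \<open>Q\<close>.\<close>

lemma transversal_edges_meet:
  assumes pre: "matching_preclusion_set graph (s ` I)"
    and s: "\<And>i. i \<in> I \<Longrightarrow> s i \<in> direction_class i"
    and ij: "i \<in> I" "j \<in> I"
  shows "s i \<inter> s j \<noteq> {}"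
proof (cases "i = j")
  case True
  then show ?thesis using s[OF ij(1)] by (auto simp: direction_class_def)
next
  case False
  have only: "e = s l" if "l \<in> I" "e \<in> s ` I" "e \<in> direction_class l" for e l
    using that s direction_classes_disjoint by blast
  show ?thesis
  proof
    assume disj: "s i \<inter> s j = {}"
    obtain x where x: "x \<in> V" "s i = {x, f i x}"
      using s[OF ij(1)] by (auto simp: direction_class_def)
    define Q where "Q = {x, f i x, f j x, f i (f j x)}"
    define g where "g y = (if y \<in> Q then j else i)" for y
    have cycle: "f i (f i x) = x" "f j (f j x) = x" "f j (f i x) = f i (f j x)"
      "f i (f i (f j x)) = f j x" "f j (f i (f j x)) = f i x"
      using x(1) ij closed involution commute[of j i] by simp_all
    have Q_i: "f i y \<in> Q" and Q_j: "f j y \<in> Q" and Q_meets: "y \<in> s i \<or> f j y \<in> s i"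
      if "y \<in> Q" for y
      using that unfolding Q_def x(2) by (elim insertE emptyE; simp add: cycle)+
    have "perfect_matching (delete_edges graph (s ` I)) ((\<lambda>y. {y, f (g y) y}) ` V)"
    proof (rule perfect_matching_from_directions)
      fix y assume y: "y \<in> V"
      show "g y \<in> I" using ij by (simp add: g_def)
      have "f i y \<in> Q \<Longrightarrow> y \<in> Q"
        using Q_i[of "f i y"] involution[OF ij(1) y] by simp
      then show "g (f (g y) y) = g y"
        using Q_j by (auto simp: g_def)
      show "{y, f (g y) y} \<notin> s ` I"
      proof
        assume del: "{y, f (g y) y} \<in> s ` I"
        show False
        proof (cases "y \<in> Q")
          case True
          then have "{y, f j y} = s j"
            using only[OF ij(2)] del y by (auto simp: g_def direction_class_def)
          then show False using Q_meets[OF True] disj by blast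
        next
          case False
          then have "{y, f i y} = s i"
            using only[OF ij(1)] del y by (auto simp: g_def direction_class_def)
          then show False using False x(2) by (auto simp: Q_def)
        qed
      qed
    qed
    then show False using pre by (auto simp: matching_preclusion_set_def)
  qed
qed

section \<open>When all optimal solutions are stars\<close>

lemma super_matched_if_four_directions:
  assumes "card I \<ge> 4"
  shows "super_matched graph"
  unfolding super_matched_def
proof (intro allI impI)
  fix S assume opt: "optimal_solution graph S"
  then have pre: "matching_preclusion_set graph S" and card_S: "card S = card I"
    by (auto simp: optimal_solution_def mp_graph)
  then have edges: "S \<subseteq> gedges graph"
    by (simp add: matching_preclusion_set_def)
  obtain s where s: "S = s ` I" "\<And>i. i \<in> I \<Longrightarrow> s i \<in> direction_class i"
    by (rule optimal_solution_transversal[OF opt]) (rule that)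
  have "e \<inter> e' \<noteq> {}" if "e \<in> S" "e' \<in> S" for e e'
    using that s transversal_edges_meet[of s] pre by auto
  moreover have "card e = 2" if "e \<in> S" for e
    using that edges edge_card_2 by blast
  ultimately obtain v where v: "\<forall>e\<in>S. v \<in> e"
    using pairwise_intersecting_pairs_common_element[of S] card_S assms by auto
  have "S \<noteq> {}" using card_S assms by auto
  then have "v \<in> V" using v edges edge_subset by blast
  have "S = star v"
    using v edges card_S card_star[OF \<open>v \<in> V\<close>] finite_edges
    by (intro card_subset_eq) (auto simp: star_def)
  then show "trivial_solution graph S"
    using \<open>v \<in> V\<close> by (auto simp: trivial_solution_def star_def graph_def)
qed

text \<open>Three directions on four vertices give the complete graph \<open>K\<^sub>4\<close>.  Deleting the triangle that avoids a vertex \<open>v\<close> leaves the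
  star of \<open>v\<close>, in which a matching has at most one edge.\<close>

lemma not_super_matched_K4:
  assumes V: "card V = 4" and I: "card I = 3"
  shows "\<not> super_matched graph"
proof
  assume super: "super_matched graph"
  obtain v where v: "v \<in> V" using nonempty_V by blast
  define S where "S = {e \<in> gedges graph. v \<notin> e}"
  have "False" if M: "perfect_matching (delete_edges graph S) M" for M
  proof -
    have at_v: "v \<in> e" "e \<in> gedges graph" if "e \<in> M" for e
      using M that by (auto simp: perfect_matching_def delete_edges_def S_def)
    have cover: "\<Union>M = V"
      using M by (simp add: perfect_matching_def delete_edges_def graph_def)
    then obtain e where e: "e \<in> M" using v by blast
    have "e' = e" if "e' \<in> M" for e'
      using M that e at_v(1)[OF that] at_v(1)[OF e]
      by (auto simp: perfect_matching_def pairwise_def disjnt_def)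
    then have "\<Union>M = e" using e by blast
    then show False using cover V edge_card_2[OF at_v(2)[OF e]] by simp
  qed
  then have pre: "matching_preclusion_set graph S"
    by (auto simp: matching_preclusion_set_def S_def)
  have "card S \<le> card {e. e \<subseteq> V - {v} \<and> card e = 2}"
    using edge_card_2 edge_subset finite_V by (intro card_mono) (auto simp: S_def)
  also have "\<dots> = 3"
    using n_subsets[of "V - {v}" 2] finite_V v V by (simp add: numeral_eq_Suc)
  finally have "optimal_solution graph S"
    using pre card_preclusion_ge[OF pre] I by (simp add: optimal_solution_def mp_graph)
  then have "trivial_solution graph S"
    using super by (simp add: super_matched_def)
  then obtain w where w: "w \<in> V" "S = star w"
    by (auto simp: trivial_solution_def star_def graph_def)
  \<comment> \<open>Every vertex is joined to \<open>v\<close> or equal to it, so its star has an edge at \<open>v\<close>.\<close>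
  have "v \<in> insert w ((\<lambda>i. f i w) ` I)"
  proof -
    have "inj_on (\<lambda>i. f i w) I"
      using separates w(1) by (auto simp: inj_on_def)
    then have "card (insert w ((\<lambda>i. f i w) ` I)) = card V"
      using moves[OF _ w(1)] finite_I V I by (force simp: card_insert_if card_image)
    then have "insert w ((\<lambda>i. f i w) ` I) = V"
      using finite_V closed w(1) by (intro card_subset_eq) auto
    then show ?thesis using v by simp
  qed
  moreover have "I \<noteq> {}" using I by auto
  ultimately obtain i where "i \<in> I" "v \<in> {w, f i w}" by blast
  moreover from this have "{w, f i w} \<in> S"
    using star_eq[OF w(1)] w(2) by auto
  ultimately show False by (auto simp: S_def)
qed

end

section \<open>The folded cube\<close>

text \<open>The generators are numbered \<open>0, \<dots>, d\<close>, the last one being the complementation.\<close>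

definition flip :: "nat \<Rightarrow> nat \<Rightarrow> bool list \<Rightarrow> bool list" where
  "flip d i x = (if i < d then x[i := \<not> x ! i] else map Not x)"

lemma length_flip [simp]: "length (flip d i x) = length x"
  by (simp add: flip_def)

lemma nth_flip:
  "\<lbrakk>length x = d; n < d\<rbrakk> \<Longrightarrow> flip d i x ! n = (if n = i \<or> d \<le> i then \<not> x ! n else x ! n)"
  by (auto simp: flip_def nth_list_update)

lemma flip_eqD:
  assumes "flip d i x = flip d j x" "length x = d" "n < d"
  shows "(n = i \<or> d \<le> i) \<longleftrightarrow> (n = j \<or> d \<le> j)"
proof -
  have "flip d i x ! n = flip d j x ! n" using assms(1) by simp
  then show ?thesis using assms(2,3) by (simp add: nth_flip split: if_splits)
qed

lemma involution_graph_flip: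
  assumes "d \<ge> 2"
  shows "involution_graph (bin_strings d) {..d} (flip d)"
proof
  have "finite {xs :: bool list. set xs \<subseteq> UNIV \<and> length xs = d}"
    by (rule finite_lists_length_eq) simp
  then show "finite (bin_strings d)" by (simp add: bin_strings_def)
  have "replicate d True \<in> bin_strings d" by (simp add: bin_strings_def)
  then show "bin_strings d \<noteq> {}" by blast
  show "finite {..d}" by simp
next
  fix i x assume "i \<in> {..d}" "x \<in> bin_strings d"
  then have x: "length x = d" and i: "i \<le> d" by (auto simp: bin_strings_def)
  show "flip d i x \<in> bin_strings d" using x by (simp add: bin_strings_def)
  show "flip d i (flip d i x) = x"
    using x by (auto intro!: nth_equalityI simp: nth_flip split: if_splits)
  define n where "n = (if i < d then i else 0)"
  have "n < d" "flip d i x ! n \<noteq> x ! n"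
    using i x assms by (auto simp: n_def nth_flip)
  then show "flip d i x \<noteq> x" by metis
next
  fix i j x assume "x \<in> bin_strings d"
  then have x: "length x = d" by (simp add: bin_strings_def)
  then show "flip d i (flip d j x) = flip d j (flip d i x)"
    by (intro nth_equalityI) (auto simp: nth_flip)
next
  fix i j x assume ij: "i \<in> {..d}" "j \<in> {..d}" "i \<noteq> j" and "x \<in> bin_strings d"
  then have x: "length x = d" by (simp add: bin_strings_def)
  show "flip d i x \<noteq> flip d j x"
  proof
    assume eq: "flip d i x = flip d j x"
    \<comment> \<open>Two coordinates are needed to tell a coordinate flip from the complementation.\<close>
    have "(0 = i \<or> d \<le> i) \<longleftrightarrow> (0 = j \<or> d \<le> j)" "(1 = i \<or> d \<le> i) \<longleftrightarrow> (1 = j \<or> d \<le> j)"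
      using flip_eqD[OF eq x] assms by auto
    moreover have "i < d \<Longrightarrow> i = j \<or> d \<le> j" "j < d \<Longrightarrow> j = i \<or> d \<le> i"
      using flip_eqD[OF eq x] by auto
    ultimately show False using ij by auto
  qed
qed

lemma differ_once_iff_flip:
  assumes "length x = d" "length y = d"
  shows "card {i. i < d \<and> x ! i \<noteq> y ! i} = 1 \<longleftrightarrow> (\<exists>i<d. y = flip d i x)"
proof
  assume "card {i. i < d \<and> x ! i \<noteq> y ! i} = 1"
  then obtain i where i: "{i. i < d \<and> x ! i \<noteq> y ! i} = {i}"
    by (auto simp: card_1_singleton_iff)
  then have "i < d" "x ! i \<noteq> y ! i" "\<And>n. n < d \<Longrightarrow> n \<noteq> i \<Longrightarrow> x ! n = y ! n"
    by blast+
  then have "y = flip d i x"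
    using assms by (intro nth_equalityI) (auto simp: nth_flip)
  with \<open>i < d\<close> show "\<exists>i<d. y = flip d i x" by blast
next
  assume "\<exists>i<d. y = flip d i x"
  then obtain i where "i < d" "y = flip d i x" by blast
  then have "{i. i < d \<and> x ! i \<noteq> y ! i} = {i}"
    using assms by (auto simp: nth_flip split: if_splits)
  then show "card {i. i < d \<and> x ! i \<noteq> y ! i} = 1" by simp
qed

lemma differ_everywhere_iff_flip:
  assumes "length x = d" "length y = d"
  shows "(\<forall>i<d. x ! i \<noteq> y ! i) \<longleftrightarrow> y = flip d d x"
proof
  assume "\<forall>i<d. x ! i \<noteq> y ! i"
  then show "y = flip d d x"
    using assms by (intro nth_equalityI) (auto simp: nth_flip)
qed (use assms in \<open>auto simp: nth_flip\<close>)

lemma folded_cube_eq_involution_graph: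
  assumes "d \<ge> 2"
  shows "folded_cube (Suc d) = involution_graph.graph (bin_strings d) {..d} (flip d)"
proof -
  interpret involution_graph "bin_strings d" "{..d}" "flip d"
    by (rule involution_graph_flip[OF assms])
  have "x \<in> bin_strings d \<and> y \<in> bin_strings d \<and> card {i. i < d \<and> x ! i \<noteq> y ! i} = 1 \<longleftrightarrow>
      x \<in> bin_strings d \<and> (\<exists>i<d. y = flip d i x)" for x y
    using differ_once_iff_flip[of x d y] closed by (auto simp: bin_strings_def)
  then have hyper: "gedges (hypercube d) = (\<Union>i<d. direction_class i)"
    unfolding hypercube_def direction_class_def by auto
  have "x \<in> bin_strings d \<and> y \<in> bin_strings d \<and> (\<forall>i<d. x ! i \<noteq> y ! i) \<longleftrightarrow>
      x \<in> bin_strings d \<and> y = flip d d x" for x y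
    using differ_everywhere_iff_flip[of x d y] closed by (auto simp: bin_strings_def)
  then have opp: "opposite_pairs d = direction_class d"
    unfolding opposite_pairs_def direction_class_def by auto
  have "(\<Union>i<d. direction_class i) \<union> direction_class d = (\<Union>i\<le>d. direction_class i)"
    by (auto simp: le_less)
  moreover have "gverts (hypercube d) = bin_strings d"
    by (simp add: hypercube_def)
  ultimately show ?thesis
    by (simp add: folded_cube_def graph_def hyper opp)
qed

theorem theorem4p1:
  fixes k :: nat
  assumes "k \<ge> 3"
  shows "super_matched (folded_cube k) \<longleftrightarrow> k \<ge> 4"
proof -
  obtain d where k: "k = Suc d" and d: "d \<ge> 2"
    using assms by (cases k) auto
  interpret involution_graph "bin_strings d" "{..d}" "flip d"
    by (rule involution_graph_flip[OF d])
  have G: "folded_cube k = graph"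
    using folded_cube_eq_involution_graph[OF d] k by simp
  show ?thesis
  proof (cases "k = 3")
    case True
    then have "card (bin_strings d) = 4"
      using card_gverts_folded_cube[of k] G by (simp add: graph_def)
    then show ?thesis
      using True not_super_matched_K4 G k by simp
  next
    case False
    then show ?thesis
      using super_matched_if_four_directions G k assms by simp
  qed
qed

end
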